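(* Let $n\in\mathbb{N}$. Let $\Psi:[0,+\infty)\times[0,+\infty)\to\mathbb{R}$ be a Borel measurable function which is nontrivial (not identically zero) and satisfies $$\Psi(a+a',b+b')-\Psi(a+a',b)-\Psi(a,b+b')+\Psi(a,b)\ge0\quad\text{for all }a,a',b,b'\in[0,+\infty)$$ and $$\Psi(u,0)=\Psi(0,v)=0\quad\text{for all }u\ge0,\ v\ge0.$$ Let $h\in C(\mathbb{R}^n)$ be a real-valued continuous function. Assume that $$\int_{\mathbb{R}^n}\int_{\mathbb{R}^n}\Psi(f(x),g(y))\,h(x-y)\,dx\,dy\le\int_{\mathbb{R}^n}\int_{\mathbb{R}^n}\Psi(f^*(x),g^*(y))\,h(x-y)\,dx\,dy$$ for all bounded nonnegative measurable functions $f$ and $g$ on $\mathbb{R}^n$ with compact support. Then $h$ is radial and radially nonincreasing, that is, there is a nonincreasing function $j:(0,+\infty)\to\mathbb{R}$ such that $h(x)=j(|x|)$ for all $x\in\mathbb{R}^n\setminus\{0\}$.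
   Context: $dx$, $dy$ denote Lebesgue measure $\mu$ on $\mathbb{R}^n$. For a nonnegative bounded measurable function $f$ with compact support on $\mathbb{R}^n$, $f^*$ is its Schwarz symmetrization (symmetric decreasing rearrangement): the unique lower semicontinuous, radially symmetric, radially nonincreasing function on $\mathbb{R}^n$ with $\mu\{a<f\le b\}=\mu\{a<f^*\le b\}$ for all $\inf f<a<b$; equivalently $f^*(x)=\sup\{t\ge 0:\mu\{f>t\}>\omega_n|x|^n\}$ (with $\sup\emptyset=0$), where $\omega_n$ is the volume of the unit ball of $\mathbb{R}^n$. *)

theory Defs
  imports "HOL-Analysis.Analysis"
begin

text \<open>The supremum is taken in the nonnegative reals, so that the supremum of the empty set is
  \<open>0\<close>; on type \<^typ>\<open>real\<close> the value of \<open>Sup {}\<close> is arbitrary. Inserting \<open>0\<close> is otherwise harmless, as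
  the set contains only nonnegative numbers. The level sets are measured by \<^const>\<open>emeasure\<close>, so
  that a level set of infinite measure is not given measure \<open>0\<close>. The supremum is meaningful
  for bounded \<open>f\<close>.\<close>

definition schwarz_symmetrization :: "(real ^ 'n \<Rightarrow> real) \<Rightarrow> real ^ 'n \<Rightarrow> real" where
  "schwarz_symmetrization f x =
     Sup (insert 0 {t. 0 \<le> t \<and>
       emeasure lebesgue {y. f y > t} >
         emeasure lebesgue (ball (0 :: real ^ 'n) 1) * ennreal (norm x ^ CARD('n))})"

text \<open>Boundedness is only asked from above because \<open>f\<close> is nonnegative.\<close>

definition admissible :: "(real ^ 'n \<Rightarrow> real) \<Rightarrow> bool" where
  "admissible f \<longleftrightarrow>
     f \<in> borel_measurable lebesgue \<and>
     (\<forall>x. 0 \<le> f x) \<and>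
     (\<exists>C. \<forall>x. f x \<le> C) \<and>
     compact (closure {x. f x \<noteq> 0})"

end

theory Submission
  imports Defs
begin

text \<open>Testing with \<open>f = u 1\<^sub>A\<close> and \<open>g = v 1\<^sub>B\<close>, where \<open>\<Psi> u v > 0\<close>, reduces the hypothesis to
  indicator functions. If \<open>\<bar>a\<bar> < R < \<bar>b\<bar>\<close> and \<open>h a < h b\<close>, let \<open>A\<close> be the ball of radius \<open>R\<close>
  about the origin with a small ball about \<open>a\<close> moved to \<open>b\<close>, and let \<open>B\<close> be a small ball about the
  origin. Symmetrization moves the small ball back and decreases the double integral of
  \<open>h (x - y)\<close>, a contradiction. Hence \<open>h a \<ge> h b\<close> whenever \<open>\<bar>a\<bar> < \<bar>b\<bar>\<close>, and by continuity
  also when \<open>\<bar>a\<bar> = \<bar>b\<bar>\<close>.\<close>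

text \<open>For \<open>t \<ge> 0\<close> the superlevel set of \<open>u * indicator A\<close> is
  \<open>A\<close> if \<open>t < u\<close> and empty otherwise. So only the comparison of
  \<open>\<omega>_n |x|^n\<close> with \<open>|A| = \<omega>_n R^n\<close> matters, that is, whether
  \<open>norm x < R\<close>. The strict inequality in the definition produces the open ball, so the
  equality holds at every point and not merely almost everywhere.\<close>

lemma schwarz_symmetrization_indicator:
  fixes A :: "(real ^ 'n) set"
  assumes "0 \<le> R" "0 < u" and A: "emeasure lebesgue A = emeasure lebesgue (ball (0 :: real ^ 'n) R)"
  shows "schwarz_symmetrization (\<lambda>x. u * indicator A x) = (\<lambda>x. u * indicator (ball 0 R) x)"
proof
  fix x :: "real ^ 'n"
  define w where "w = unit_ball_vol (real CARD('n))"
  have w: "w > 0" by (simp add: w_def)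
  have unit: "emeasure lebesgue (ball (0 :: real ^ 'n) 1) = ennreal w"
    by (simp add: emeasure_ball w_def)
  have A': "emeasure lebesgue A = ennreal (w * R ^ CARD('n))"
    using A \<open>0 \<le> R\<close> by (simp add: emeasure_ball w_def)
  have lev: "{y. u * indicator A y > t} = (if t < u then A else {})" if "0 \<le> t" for t
    using that \<open>0 < u\<close> by (auto simp: indicator_def split: if_splits)
  have gt: "ennreal w * ennreal (norm x ^ CARD('n)) < emeasure lebesgue A \<longleftrightarrow> norm x < R"
  proof -
    have "ennreal w * ennreal (norm x ^ CARD('n)) < emeasure lebesgue A
        \<longleftrightarrow> w * norm x ^ CARD('n) < w * R ^ CARD('n)"
      using w by (simp add: A' ennreal_mult[symmetric] ennreal_less_iff)
    also have "\<dots> \<longleftrightarrow> norm x ^ CARD('n) < R ^ CARD('n)"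
      using w by simp
    also have "\<dots> \<longleftrightarrow> norm x < R"
      using \<open>0 \<le> R\<close> by (metis norm_ge_zero power_less_imp_less_base power_strict_mono zero_less_card_finite)
    finally show ?thesis .
  qed
  have "{t. 0 \<le> t \<and> emeasure lebesgue {y. u * indicator A y > t} >
      ennreal w * ennreal (norm x ^ CARD('n))} = (if norm x < R then {0..<u} else {})"
    using gt by (auto simp: lev split: if_splits)
  \<comment> \<open>The inserted \<open>0\<close> changes nothing inside the ball, where the
    supremum is \<open>u\<close>. Outside it is the only element and yields the value
    \<open>0\<close>.\<close>
  moreover have "insert 0 {0..<u} = {0..<u}"
    using \<open>0 < u\<close> by auto
  ultimately show "schwarz_symmetrization (\<lambda>x. u * indicator A x) x = u * indicator (ball 0 R) x"
    using \<open>0 < u\<close> by (simp add: schwarz_symmetrization_def unit)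
qed

lemma admissible_indicator:
  assumes "A \<in> sets lebesgue" "bounded A" "0 < u"
  shows "admissible (\<lambda>x. u * indicator A x)"
proof -
  have "{x. u * indicator A x \<noteq> 0} = A"
    using \<open>0 < u\<close> by (auto simp: indicator_def)
  then show ?thesis
    using assms unfolding admissible_def by (auto simp: compact_closure simp: indicator_def intro!: exI[of _ u])
qed

lemma set_integrable_continuous_bounded:
  fixes f :: "'a::euclidean_space \<Rightarrow> real"
  assumes "continuous_on UNIV f" "S \<in> sets borel" "bounded S"
  shows "integrable lborel (\<lambda>x. indicator S x * f x)"
proof -
  have "set_integrable lborel (closure S) f"
    unfolding set_integrable_def
    using assms by (intro borel_integrable_compact) (auto simp: compact_closure intro: continuous_on_subset)
  then have "set_integrable lborel S f"
    using assms closure_subset by (rule_tac set_integrable_subset) auto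
  then show ?thesis
    by (simp add: set_integrable_def)
qed

text \<open>A Bochner integral defaults to \<open>0\<close> when the integrand is not integrable, so
  comparing iterated integrals requires integrability of the outer integrand too. It holds because
  the inner integral is bounded for \<open>y\<close> in \<open>B\<close> and \<open>B\<close> has
  finite measure.\<close>

lemma integrable_bounded_set_convolution:
  fixes h :: "'a::euclidean_space \<Rightarrow> real"
  assumes h: "continuous_on UNIV h"
    and A: "A \<in> sets borel" "bounded A" and B: "B \<in> sets borel" "bounded B"
  shows "integrable lborel (\<lambda>y. indicator B y * (\<integral>x. indicator A x * h (x - y) \<partial>lborel))"
proof -
  have [measurable]: "h \<in> borel_measurable borel"
    using h by (rule borel_measurable_continuous_onI)
  note [measurable] = A(1) B(1)
  have fin: "emeasure lborel A < \<infinity>" "emeasure lborel B < \<infinity>"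
    using A B emeasure_bounded_finite by auto
  obtain r s where r: "\<And>x. x \<in> A \<Longrightarrow> norm x \<le> r" and s: "\<And>y. y \<in> B \<Longrightarrow> norm y \<le> s"
    using A(2) B(2) unfolding bounded_iff by blast
  \<comment> \<open>For \<open>x\<close> in \<open>A\<close> and \<open>y\<close> in
    \<open>B\<close> the difference \<open>x - y\<close> stays in this compact ball, which gives a
    bound on \<open>h (x - y)\<close> uniform in both variables.\<close>
  have "bounded (h ` cball 0 (r + s))"
    using h by (intro compact_imp_bounded compact_continuous_image) (auto intro: continuous_on_subset)
  then obtain M where M: "\<forall>z. norm z \<le> r + s \<longrightarrow> \<bar>h z\<bar> \<le> M"
    unfolding bounded_iff by (metis imageI mem_cball_0 real_norm_def)
  have bound: "\<bar>\<integral>x. indicator A x * h (x - y) \<partial>lborel\<bar> \<le> M * measure lborel A" if "y \<in> B" for y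
  proof -
    have "\<bar>\<integral>x. indicator A x * h (x - y) \<partial>lborel\<bar> \<le> (\<integral>x. \<bar>indicator A x * h (x - y)\<bar> \<partial>lborel)"
      by (rule integral_abs_bound)
    also have "\<dots> \<le> (\<integral>x. indicator A x * M \<partial>lborel)"
    proof (rule integral_mono)
      show "integrable lborel (\<lambda>x. \<bar>indicator A x * h (x - y)\<bar>)"
        using A h by (intro integrable_abs set_integrable_continuous_bounded)
          (auto intro!: continuous_intros continuous_on_compose2[OF h])
      show "integrable lborel (\<lambda>x. indicator A x * M)"
        using A fin by (intro integrable_mult_left integrable_real_indicator) auto
      show "\<bar>indicator A x * h (x - y)\<bar> \<le> indicator A x * M" for x
        using M[rule_format, of "x - y"] r[of x] s[OF that] norm_triangle_ineq4[of x y]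
        by (auto simp: indicator_def)
    qed
    also have "\<dots> = M * measure lborel A"
      by (simp add: mult.commute)
    finally show ?thesis .
  qed
  show ?thesis
  proof (rule integrableI_bounded_set[where A = B and B = "M * measure lborel A"])
    show "(\<lambda>y. indicator B y * (\<integral>x. indicator A x * h (x - y) \<partial>lborel)) \<in> borel_measurable lborel"
      by measurable
  qed (use B fin bound in \<open>auto simp: indicator_def\<close>)
qed

text \<open>Shifting \<open>ball c \<delta>\<close> by a vector shorter than \<open>\<delta>\<close>
  keeps it within distance \<open>2 * \<delta>\<close> of \<open>c\<close>, so a bound for
  \<open>h\<close> there passes to the integral.\<close>

lemma integral_indicator_ball_diff_bounds:
  fixes h :: "'a::euclidean_space \<Rightarrow> real"
  assumes h: "continuous_on UNIV h" and y: "norm y < \<delta>"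
  shows "(\<And>z. dist c z < 2 * \<delta> \<Longrightarrow> m \<le> h z) \<Longrightarrow>
      m * measure lborel (ball c \<delta>) \<le> (\<integral>x. indicator (ball c \<delta>) x * h (x - y) \<partial>lborel)"
    and "(\<And>z. dist c z < 2 * \<delta> \<Longrightarrow> h z \<le> m) \<Longrightarrow>
      (\<integral>x. indicator (ball c \<delta>) x * h (x - y) \<partial>lborel) \<le> m * measure lborel (ball c \<delta>)"
proof -
  have int: "integrable lborel (\<lambda>x. indicator (ball c \<delta>) x * h (x - y))"
    using h by (intro set_integrable_continuous_bounded)
      (auto intro!: continuous_intros continuous_on_compose2[OF h])
  have int': "integrable lborel (\<lambda>x. indicator (ball c \<delta>) x * m)"
    by (intro set_integrable_continuous_bounded) auto
  have near: "dist c (x - y) < 2 * \<delta>" if "dist c x < \<delta>" for x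
    using that y norm_triangle_ineq[of "c - x" y] by (simp add: dist_norm algebra_simps)
  have eq: "m * measure lborel (ball c \<delta>) = (\<integral>x. indicator (ball c \<delta>) x * m \<partial>lborel)"
    by (simp add: mult.commute)
  show "m * measure lborel (ball c \<delta>) \<le> (\<integral>x. indicator (ball c \<delta>) x * h (x - y) \<partial>lborel)"
    if "\<And>z. dist c z < 2 * \<delta> \<Longrightarrow> m \<le> h z"
    unfolding eq using that near by (intro integral_mono int int') (auto simp: indicator_def)
  show "(\<integral>x. indicator (ball c \<delta>) x * h (x - y) \<partial>lborel) \<le> m * measure lborel (ball c \<delta>)"
    if "\<And>z. dist c z < 2 * \<delta> \<Longrightarrow> h z \<le> m"
    unfolding eq using that near by (intro integral_mono int int') (auto simp: indicator_def)
qed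

text \<open>The set tested in \<open>y\<close> is a ball about the origin, which is its own
  rearrangement. Hence only \<open>A\<close> changes between the two sides.\<close>

lemma nonincreasing_if_indicator_rearrangement:
  fixes h :: "'a::euclidean_space \<Rightarrow> real"
  assumes h: "continuous_on UNIV h"
    and rearrangement:
      "\<And>A R r. \<lbrakk>A \<in> sets borel; bounded A; 0 < R; 0 < r;
          emeasure lborel A = emeasure lborel (ball (0 :: 'a) R)\<rbrakk> \<Longrightarrow>
        (\<integral>y. indicator (ball 0 r) y * (\<integral>x. indicator A x * h (x - y) \<partial>lborel) \<partial>lborel)
        \<le> (\<integral>y. indicator (ball 0 r) y * (\<integral>x. indicator (ball 0 R) x * h (x - y) \<partial>lborel) \<partial>lborel)"
    and ab: "norm a < norm b"
  shows "h b \<le> h a"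
proof (rule ccontr)
  assume "\<not> h b \<le> h a"
  \<comment> \<open>With a third of the gap, an error below \<open>\<eta>\<close> at each of
    \<open>a\<close> and \<open>b\<close> still leaves a gap of \<open>\<eta>\<close>.\<close>
  define \<eta> where "\<eta> = (h b - h a) / 3"
  have \<eta>: "\<eta> > 0" using \<open>\<not> h b \<le> h a\<close> by (simp add: \<eta>_def)
  obtain d e where d: "d > 0" "\<And>z. dist a z < d \<Longrightarrow> \<bar>h z - h a\<bar> < \<eta>"
    and e: "e > 0" "\<And>z. dist b z < e \<Longrightarrow> \<bar>h z - h b\<bar> < \<eta>"
    using h \<eta> unfolding continuous_on_iff by (metis UNIV_I dist_commute dist_real_def)
  define R where "R = (norm a + norm b) / 2"
  have R: "norm a < R" "R < norm b" using ab by (auto simp: R_def)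
  then have "R > 0" using norm_ge_zero[of a] by linarith
  \<comment> \<open>The halves are there because \<open>x - y\<close> ranges over balls of radius
    \<open>2 * \<delta>\<close>. The other two terms put \<open>ball a \<delta>\<close> inside
    \<open>ball 0 R\<close> and \<open>ball b \<delta>\<close> outside it.\<close>
  define \<delta> where "\<delta> = min (min (d / 2) (e / 2)) (min (R - norm a) (norm b - R))"
  have \<delta>: "\<delta> > 0" "2 * \<delta> \<le> d" "2 * \<delta> \<le> e" "\<delta> \<le> R - norm a" "\<delta> \<le> norm b - R"
    using d(1) e(1) R by (auto simp: \<delta>_def min_def)
  have sub: "ball a \<delta> \<subseteq> ball 0 R"
  proof
    fix x assume "x \<in> ball a \<delta>"
    then show "x \<in> ball 0 R"
      using \<delta> norm_triangle_ineq2[of x a] by (simp add: dist_norm norm_minus_commute)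
  qed
  have dis: "ball b \<delta> \<inter> ball 0 R = {}"
  proof -
    have "\<not> norm x < R" if "dist b x < \<delta>" for x
      using that \<delta> norm_triangle_ineq2[of b x] by (simp add: dist_norm)
    then show ?thesis by auto
  qed
  define A where "A = (ball 0 R - ball a \<delta>) \<union> ball b \<delta>"
  have A: "A \<in> sets borel" "bounded A" by (auto simp: A_def)
  have "emeasure lborel A = emeasure lborel (ball 0 R - ball a \<delta>) + emeasure lborel (ball b \<delta>)"
    unfolding A_def using dis by (intro plus_emeasure[symmetric]) auto
  also have "emeasure lborel (ball b \<delta>) = emeasure lborel (ball a \<delta>)"
    using \<delta> by (simp add: emeasure_ball)
  also have "emeasure lborel (ball 0 R - ball a \<delta>) + \<dots>
      = emeasure lborel ((ball 0 R - ball a \<delta>) \<union> ball a \<delta>)"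
    by (intro plus_emeasure) auto
  also have "(ball 0 R - ball a \<delta>) \<union> ball a \<delta> = ball 0 R" using sub by auto
  finally have mA: "emeasure lborel A = emeasure lborel (ball (0 :: 'a) R)" .

  define K where "K S y = (\<integral>x. indicator S x * h (x - y) \<partial>lborel)" for S y
  define m where "m = measure lborel (ball (0::'a) \<delta>)"
  have meas: "measure lborel (ball c \<delta>) = m" for c :: 'a
    using \<delta> by (simp add: m_def content_ball)
  have m: "m > 0" using \<delta> by (simp add: m_def content_ball)
  \<comment> \<open>For each \<open>y\<close> in the test ball, moving the small ball from
    \<open>a\<close> to \<open>b\<close> gains at least \<open>\<eta> * m\<close>: by inclusion and
    disjointness the change is exactly
    \<open>K (ball b \<delta>) y - K (ball a \<delta>) y\<close>.\<close>
  have KA: "K (ball 0 R) y + \<eta> * m \<le> K A y" if "norm y < \<delta>" for y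
  proof -
    have int: "integrable lborel (\<lambda>x. indicator (ball c r) x * h (x - y))" for c r
      by (intro set_integrable_continuous_bounded)
        (auto intro!: continuous_intros continuous_on_compose2[OF h])
    have "indicator A x * h (x - y) = indicator (ball 0 R) x * h (x - y)
        - indicator (ball a \<delta>) x * h (x - y) + indicator (ball b \<delta>) x * h (x - y)" for x
      using sub dis by (auto simp: A_def indicator_def)
    then have "K A y = K (ball 0 R) y - K (ball a \<delta>) y + K (ball b \<delta>) y"
      using int by (simp add: K_def)
    moreover have "K (ball a \<delta>) y \<le> (h a + \<eta>) * m"
      unfolding K_def meas[of a, symmetric]
    proof (rule integral_indicator_ball_diff_bounds(2)[OF h that])
      fix z assume "dist a z < 2 * \<delta>"
      then show "h z \<le> h a + \<eta>" using d(2)[of z] \<delta> by auto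
    qed
    moreover have "(h b - \<eta>) * m \<le> K (ball b \<delta>) y"
      unfolding K_def meas[of b, symmetric]
    proof (rule integral_indicator_ball_diff_bounds(1)[OF h that])
      fix z assume "dist b z < 2 * \<delta>"
      then show "h b - \<eta> \<le> h z" using e(2)[of z] \<delta> by auto
    qed
    moreover have "(h b - \<eta>) * m = (h a + \<eta>) * m + \<eta> * m"
      by (simp add: \<eta>_def field_simps)
    ultimately show ?thesis by linarith
  qed
  have int: "integrable lborel (\<lambda>y. indicator (ball 0 \<delta>) y * K S y)"
    if "S \<in> sets borel" "bounded S" for S
    unfolding K_def using that by (intro integrable_bounded_set_convolution h) auto
  have int': "integrable lborel (\<lambda>y. indicator (ball 0 \<delta>) y * (\<eta> * m) :: real)"
    by (intro set_integrable_continuous_bounded) auto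
  \<comment> \<open>Integrating the gain over the test ball, whose measure is again
    \<open>m\<close>, gives a total gain of \<open>\<eta> * m * m > 0\<close>, which the
    rearrangement inequality forbids.\<close>
  have "(\<integral>y. indicator (ball 0 \<delta>) y * K (ball 0 R) y \<partial>lborel) + \<eta> * m * m
      = (\<integral>y. indicator (ball 0 \<delta>) y * K (ball 0 R) y + indicator (ball 0 \<delta>) y * (\<eta> * m) \<partial>lborel)"
    using int int' by (subst Bochner_Integration.integral_add) (auto simp: m_def)
  also have "\<dots> \<le> (\<integral>y. indicator (ball 0 \<delta>) y * K A y \<partial>lborel)"
    using KA A by (intro integral_mono int int' Bochner_Integration.integrable_add)
      (auto simp: indicator_def)
  also have "\<dots> \<le> (\<integral>y. indicator (ball 0 \<delta>) y * K (ball 0 R) y \<partial>lborel)"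
    unfolding K_def using A \<open>R > 0\<close> \<delta> mA by (intro rearrangement) auto
  finally show False using mult_pos_pos[OF mult_pos_pos[OF \<eta> m] m] by simp
qed

lemma radial_nonincreasing:
  fixes h :: "'a::euclidean_space \<Rightarrow> real"
  assumes h: "continuous_on UNIV h" and dec: "\<And>a b. norm a < norm b \<Longrightarrow> h b \<le> h a"
  shows "\<exists>j :: real \<Rightarrow> real. antimono_on {0<..} j \<and> (\<forall>x. x \<noteq> 0 \<longrightarrow> h x = j (norm x))"
proof -
  \<comment> \<open>On a sphere, \<open>t *\<^sub>R a\<close> with \<open>0 < t < 1\<close> has norm
    strictly below \<open>norm b\<close>, so \<open>dec\<close> applies to it; let \<open>t\<close>
    tend to \<open>1\<close> from the left. Exchanging the two points shows that \<open>h\<close> is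
    constant on the sphere.\<close>
  have le: "h b \<le> h a" if "norm a = norm b" "b \<noteq> 0" for a b
  proof (rule tendsto_lowerbound)
    have "((\<lambda>t. h (t *\<^sub>R a)) \<longlongrightarrow> h (1 *\<^sub>R a)) (at_left 1)"
      by (rule isCont_tendsto_compose[of _ h])
        (use h in \<open>auto simp: continuous_on_eq_continuous_at intro!: tendsto_eq_intros\<close>)
    then show "((\<lambda>t. h (t *\<^sub>R a)) \<longlongrightarrow> h a) (at_left 1)" by simp
    have "\<forall>\<^sub>F t in at_left (1::real). t \<in> {0<..<1}"
      by (rule eventually_at_leftI[of 0]) auto
    then show "\<forall>\<^sub>F t in at_left (1::real). h b \<le> h (t *\<^sub>R a)"
      by eventually_elim (use that in \<open>auto intro!: dec\<close>)
  qed auto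
  \<comment> \<open>The profile \<open>j\<close> is \<open>h\<close> along the ray through a unit
    vector.\<close>
  obtain e :: 'a where e: "norm e = 1"
    using vector_choose_size zero_le_one by blast
  show ?thesis
  proof (intro exI[of _ "\<lambda>r. h (r *\<^sub>R e)"] conjI allI impI)
    show "antimono_on {0<..} (\<lambda>r. h (r *\<^sub>R e))"
    proof (rule monotone_onI)
      fix r s :: real assume "r \<in> {0<..}" "s \<in> {0<..}" "r \<le> s"
      then show "h (r *\<^sub>R e) \<ge> h (s *\<^sub>R e)"
        by (cases "r = s") (auto intro!: dec simp: e)
    qed
    fix x :: 'a assume "x \<noteq> 0"
    moreover from this have "norm x *\<^sub>R e \<noteq> 0" using e by auto
    ultimately show "h x = h (norm x *\<^sub>R e)"
      using e by (intro antisym le) auto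
  qed
qed

theorem proposition3p3:
  fixes \<Psi> :: "real \<Rightarrow> real \<Rightarrow> real"
    and h :: "real ^ 'n \<Rightarrow> real"
  assumes Psi_measurable:
      "(\<lambda>(u, v). \<Psi> u v) \<in> borel_measurable (restrict_space borel ({0..} \<times> {0..}))"
    and Psi_nontrivial: "\<exists>u\<ge>0. \<exists>v\<ge>0. \<Psi> u v \<noteq> 0"
    and Psi_supermodular:
      "\<And>a a' b b'. a \<ge> 0 \<Longrightarrow> a' \<ge> 0 \<Longrightarrow> b \<ge> 0 \<Longrightarrow> b' \<ge> 0 \<Longrightarrow>
         \<Psi> (a + a') (b + b') - \<Psi> (a + a') b - \<Psi> a (b + b') + \<Psi> a b \<ge> 0"
    and Psi_zero_right: "\<And>u. u \<ge> 0 \<Longrightarrow> \<Psi> u 0 = 0"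
    and Psi_zero_left: "\<And>v. v \<ge> 0 \<Longrightarrow> \<Psi> 0 v = 0"
    and h_continuous: "continuous_on UNIV h"
    and rearrangement:
      "\<And>f g. admissible f \<Longrightarrow> admissible g \<Longrightarrow>
         (\<integral>y. (\<integral>x. \<Psi> (f x) (g y) * h (x - y) \<partial>lebesgue) \<partial>lebesgue)
         \<le> (\<integral>y. (\<integral>x. \<Psi> (schwarz_symmetrization f x) (schwarz_symmetrization g y) * h (x - y)
               \<partial>lebesgue) \<partial>lebesgue)"
  shows "\<exists>j :: real \<Rightarrow> real. antimono_on {0<..} j \<and> (\<forall>x. x \<noteq> 0 \<longrightarrow> h x = j (norm x))"
proof (rule radial_nonincreasing[OF h_continuous])
  fix a b :: "real ^ 'n" assume ab: "norm a < norm b"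
  obtain u v where uv: "u \<ge> 0" "v \<ge> 0" "\<Psi> u v \<noteq> 0"
    using Psi_nontrivial by blast
  have "u \<noteq> 0" "v \<noteq> 0" using uv Psi_zero_left Psi_zero_right by auto
  with uv have u: "u > 0" and v: "v > 0" by auto
  \<comment> \<open>Supermodularity based at the origin gives \<open>\<Psi> u v \<ge> 0\<close>,
    since the other three terms lie on the axes. Positivity allows this factor to be cancelled from
    the inequality at the end.\<close>
  have pos: "\<Psi> u v > 0"
    using Psi_supermodular[of 0 u 0 v] uv Psi_zero_left Psi_zero_right by simp
  have [measurable]: "h \<in> borel_measurable borel"
    using h_continuous by (rule borel_measurable_continuous_onI)
  \<comment> \<open>As \<open>\<Psi>\<close> vanishes on both axes, on two-valued functions it acts
    as the product of the indicators times \<open>\<Psi> u v\<close>. The integrands are Borel, so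
    integration over \<open>lebesgue\<close> and \<open>lborel\<close> agrees.\<close>
  have step: "(\<integral>y. (\<integral>x. \<Psi> (u * indicator A x) (v * indicator B y) * h (x - y) \<partial>lebesgue) \<partial>lebesgue)
      = \<Psi> u v * (\<integral>y. indicator B y * (\<integral>x. indicator A x * h (x - y) \<partial>lborel) \<partial>lborel)"
    if [measurable]: "A \<in> sets borel" "B \<in> sets borel" for A B :: "(real ^ 'n) set"
  proof -
    have "\<Psi> (u * indicator A x) (v * indicator B y) = \<Psi> u v * indicator B y * indicator A x" for x y
      using u v Psi_zero_left Psi_zero_right by (auto simp: indicator_def)
    then show ?thesis
      by (simp add: integral_completion mult.assoc)
  qed
  show "h b \<le> h a"
  proof (rule nonincreasing_if_indicator_rearrangement[OF h_continuous _ ab])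
    fix A :: "(real ^ 'n) set" and R r :: real
    assume A: "A \<in> sets borel" "bounded A" and "0 < R" "0 < r"
      and "emeasure lborel A = emeasure lborel (ball (0 :: real ^ 'n) R)"
    then have sA: "schwarz_symmetrization (\<lambda>x. u * indicator A x) = (\<lambda>x. u * indicator (ball 0 R) x)"
      using u by (intro schwarz_symmetrization_indicator) auto
    have sB: "schwarz_symmetrization (\<lambda>x :: real ^ 'n. v * indicator (ball 0 r) x)
        = (\<lambda>x. v * indicator (ball 0 r) x)"
      using v \<open>0 < r\<close> by (intro schwarz_symmetrization_indicator) auto
    have "admissible (\<lambda>x. u * indicator A x)"
      "admissible (\<lambda>x :: real ^ 'n. v * indicator (ball 0 r) x)"
      using A u v by (auto intro!: admissible_indicator)
    from rearrangement[OF this] show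
      "(\<integral>y. indicator (ball 0 r) y * (\<integral>x. indicator A x * h (x - y) \<partial>lborel) \<partial>lborel)
        \<le> (\<integral>y. indicator (ball 0 r) y * (\<integral>x. indicator (ball 0 R) x * h (x - y) \<partial>lborel) \<partial>lborel)"
      using A pos by (simp add: sA sB step)
  qed
qed

end
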